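(* Let $\mathbf{Q}$ be a quantale. If $\{\mathbf{M}_i\}_{i\in I}$ is a family of projective (respectively: injective) $\mathbf{Q}$-modules, then $\prod_{i\in I}\mathbf{M}_i$ is projective (respectively: injective) as well.
   Context: A quantale $\mathbf{Q}=\langle Q,\vee,\cdot,\bot,e\rangle$ is a complete lattice with a monoid structure whose product distributes over arbitrary joins in both arguments. A left $\mathbf{Q}$-module is a sup-lattice (poset with arbitrary joins) $\mathbf{M}$ with $\star:Q\times M\to M$ preserving arbitrary joins in each argument, with $(q_1q_2)\star m=q_1\star(q_2\star m)$ and $e\star m=m$; right modules are analogous; "$\mathbf{Q}$-module" means consistently left or consistently right. Homomorphisms preserve arbitrary joins and scalar multiplication. Products are Cartesian products with coordinatewise operations. A module $\mathbf{C}$ is projective if for every homomorphism $f:\mathbf{C}\to\mathbf{B}$ and every surjective homomorphism $e:\mathbf{A}\to\mathbf{B}$ there is a homomorphism $h:\mathbf{C}\to\mathbf{A}$ with $e\circ h=f$; it is injective if for every injective homomorphism $m:\mathbf{B}\to\mathbf{A}$ and every homomorphism $f:\mathbf{B}\to\mathbf{C}$ there is a homomorphism $g:\mathbf{A}\to\mathbf{C}$ with $g\circ m=f$. *)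

theory Defs
  imports "HOL-Algebra.Complete_Lattice" "HOL-Library.FuncSet"
begin

class quantale = complete_lattice + monoid_mult +
  assumes mult_Sup: "a * Sup X = Sup ((\<lambda>x. a * x) ` X)"
    and Sup_mult: "Sup X * a = Sup ((\<lambda>x. x * a) ` X)"

locale sup_lattice = partial_order +
  assumes lub_exists: "X \<subseteq> carrier L \<Longrightarrow> \<exists>s. is_lub L s X"

text \<open>The scalar is always written on the left of \<open>\<star>\<close>; for a right module, \<open>q \<star> m\<close> stands for
  what is usually written with the scalar on the right of \<open>m\<close>.\<close>

record ('m, 'q) qmodule = "'m gorder" +
  act :: "'q \<Rightarrow> 'm \<Rightarrow> 'm"  (infixr \<open>\<star>\<index>\<close> 75)

locale pre_qmodule = sup_lattice M for M :: "('m, 'q::quantale) qmodule" (structure) +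
  assumes act_closed: "m \<in> carrier M \<Longrightarrow> q \<star> m \<in> carrier M"
    and Sup_act: "m \<in> carrier M \<Longrightarrow> Sup X \<star> m = \<Squnion>\<^bsub>M\<^esub> ((\<lambda>q. q \<star> m) ` X)"
    and act_sup: "Y \<subseteq> carrier M \<Longrightarrow> q \<star> (\<Squnion>\<^bsub>M\<^esub> Y) = \<Squnion>\<^bsub>M\<^esub> ((\<lambda>m. q \<star> m) ` Y)"
    and one_act: "m \<in> carrier M \<Longrightarrow> 1 \<star> m = m"

locale left_qmodule = pre_qmodule +
  assumes mult_act: "m \<in> carrier M \<Longrightarrow> (p * q) \<star> m = p \<star> (q \<star> m)"

locale right_qmodule = pre_qmodule +
  assumes mult_act: "m \<in> carrier M \<Longrightarrow> (p * q) \<star> m = q \<star> (p \<star> m)"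

datatype side = Left | Right

fun is_qmodule :: "side \<Rightarrow> ('m, 'q::quantale) qmodule \<Rightarrow> bool" where
  "is_qmodule Left M = left_qmodule M"
| "is_qmodule Right M = right_qmodule M"

definition qmodule_hom :: "('a, 'q) qmodule \<Rightarrow> ('b, 'q) qmodule \<Rightarrow> ('a \<Rightarrow> 'b) set" where
  "qmodule_hom A B = {f \<in> carrier A \<rightarrow> carrier B.
     (\<forall>X\<subseteq>carrier A. f (\<Squnion>\<^bsub>A\<^esub> X) = \<Squnion>\<^bsub>B\<^esub> (f ` X)) \<and>
     (\<forall>q. \<forall>x\<in>carrier A. f (q \<star>\<^bsub>A\<^esub> x) = q \<star>\<^bsub>B\<^esub> f x)}"

definition qmodule_prod :: "'i set \<Rightarrow> ('i \<Rightarrow> ('m, 'q) qmodule) \<Rightarrow> ('i \<Rightarrow> 'm, 'q) qmodule" where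
  "qmodule_prod I M = \<lparr>
     carrier = (\<Pi>\<^sub>E i\<in>I. carrier (M i)),
     eq = (=),
     le = (\<lambda>x y. \<forall>i\<in>I. x i \<sqsubseteq>\<^bsub>M i\<^esub> y i),
     act = (\<lambda>q x. \<lambda>i\<in>I. q \<star>\<^bsub>M i\<^esub> x i)\<rparr>"

text \<open>HOL cannot quantify over types inside a formula. The types \<open>'a\<close> and \<open>'b\<close> that carry the
  test modules \<open>A\<close> and \<open>B\<close> are therefore parameters of the two notions below. They are independent
  of the type \<open>'c\<close> of the module under consideration; the absolute notions are obtained by letting
  \<open>'a\<close> and \<open>'b\<close> range over all types.\<close>

definition projective_qmodule ::
    "side \<Rightarrow> 'a itself \<Rightarrow> 'b itself \<Rightarrow> ('c, 'q::quantale) qmodule \<Rightarrow> bool" where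
  "projective_qmodule s TA TB C \<longleftrightarrow> is_qmodule s C \<and>
     (\<forall>(A :: ('a, 'q) qmodule) (B :: ('b, 'q) qmodule).
        is_qmodule s A \<and> is_qmodule s B \<longrightarrow>
        (\<forall>f\<in>qmodule_hom C B. \<forall>e\<in>qmodule_hom A B. e ` carrier A = carrier B \<longrightarrow>
           (\<exists>h\<in>qmodule_hom C A. \<forall>x\<in>carrier C. e (h x) = f x)))"

definition injective_qmodule ::
    "side \<Rightarrow> 'a itself \<Rightarrow> 'b itself \<Rightarrow> ('c, 'q::quantale) qmodule \<Rightarrow> bool" where
  "injective_qmodule s TA TB C \<longleftrightarrow> is_qmodule s C \<and>
     (\<forall>(A :: ('a, 'q) qmodule) (B :: ('b, 'q) qmodule).
        is_qmodule s A \<and> is_qmodule s B \<longrightarrow>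
        (\<forall>m\<in>qmodule_hom B A. \<forall>f\<in>qmodule_hom B C. inj_on m (carrier B) \<longrightarrow>
           (\<exists>g\<in>qmodule_hom A C. \<forall>x\<in>carrier B. g (m x) = f x)))"

end

theory Submission
  imports Defs
begin

text \<open>Because homomorphisms preserve arbitrary joins, the product of modules is also their coproduct:
  the embeddings \<open>\<iota>\<^sub>i\<close> that fill all other coordinates with \<open>\<bottom>\<close> satisfy
  \<open>x = \<Squnion>\<^sub>i \<iota>\<^sub>i (x\<^sub>i)\<close>. So liftings \<open>h\<^sub>i\<close> of \<open>f \<circ> \<iota>\<^sub>i\<close> glue to the lifting
  \<open>x \<mapsto> \<Squnion>\<^sub>i h\<^sub>i (x\<^sub>i)\<close> of \<open>f\<close>, and dually extensions \<open>g\<^sub>i\<close> of the coordinates of \<open>f\<close>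
  assemble to an extension of \<open>f\<close>.\<close>

section \<open>Joins in a sup-lattice\<close>

context sup_lattice
begin

text \<open>The operator \<open>\<Squnion>\<close> is defined by choice, so it denotes a least upper
  bound only where one exists. The sup-lattice axiom provides existence for every subset of the
  carrier, including the empty one, whose join is the least element.\<close>

lemma least_sup:
  assumes "X \<subseteq> carrier L"
  shows "least L (\<Squnion>X) (Upper L X)"
  unfolding sup_def using lub_exists[OF assms] by (rule someI_ex)

lemma sup_in_carrier: "X \<subseteq> carrier L \<Longrightarrow> \<Squnion>X \<in> carrier L"
  using least_sup by (rule least_closed)

lemma sup_ge: "X \<subseteq> carrier L \<Longrightarrow> x \<in> X \<Longrightarrow> x \<sqsubseteq> \<Squnion>X"
  using least_sup[of X] unfolding least_def Upper_def by blast

lemma sup_least: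
  "X \<subseteq> carrier L \<Longrightarrow> u \<in> carrier L \<Longrightarrow> (\<And>x. x \<in> X \<Longrightarrow> x \<sqsubseteq> u) \<Longrightarrow> \<Squnion>X \<sqsubseteq> u"
  using least_sup[of X] unfolding least_def Upper_def by blast

lemma sup_eqI:
  assumes "X \<subseteq> carrier L" "u \<in> carrier L" "\<And>x. x \<in> X \<Longrightarrow> x \<sqsubseteq> u"
    and "\<And>v. v \<in> carrier L \<Longrightarrow> (\<And>x. x \<in> X \<Longrightarrow> x \<sqsubseteq> v) \<Longrightarrow> u \<sqsubseteq> v"
  shows "\<Squnion>X = u"
proof (rule le_antisym)
  show "\<Squnion>X \<in> carrier L"
    using assms(1) by (rule sup_in_carrier)
  then show "u \<sqsubseteq> \<Squnion>X"
    using assms(1) by (intro assms(4) sup_ge)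
  show "\<Squnion>X \<sqsubseteq> u"
    using assms(1-3) by (rule sup_least)
qed (fact assms(2))

text \<open>Both sets have the same upper bounds: by transitivity, bounding every
  \<open>\<Squnion>(F i)\<close> amounts to bounding every element of every
  \<open>F i\<close>.\<close>

lemma sup_UN_eq:
  assumes "\<And>i. i \<in> I \<Longrightarrow> F i \<subseteq> carrier L"
  shows "\<Squnion>((\<lambda>i. \<Squnion>(F i)) ` I) = \<Squnion>(\<Union>i\<in>I. F i)"
proof (rule sup_eqI)
  have U: "(\<Union>i\<in>I. F i) \<subseteq> carrier L"
    using assms by blast
  show "(\<lambda>i. \<Squnion>(F i)) ` I \<subseteq> carrier L"
    using assms by (auto intro: sup_in_carrier)
  show c: "\<Squnion>(\<Union>i\<in>I. F i) \<in> carrier L"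
    using U by (rule sup_in_carrier)
  show "x \<sqsubseteq> \<Squnion>(\<Union>i\<in>I. F i)" if x: "x \<in> (\<lambda>i. \<Squnion>(F i)) ` I" for x
  proof -
    obtain i where i: "i \<in> I" "x = \<Squnion>(F i)" using x by blast
    show ?thesis unfolding i(2)
    proof (rule sup_least[OF assms[OF i(1)] c])
      show "y \<sqsubseteq> \<Squnion>(\<Union>i\<in>I. F i)" if "y \<in> F i" for y
        using that i(1) by (intro sup_ge[OF U]) blast
    qed
  qed
  show "\<Squnion>(\<Union>i\<in>I. F i) \<sqsubseteq> v"
    if v: "v \<in> carrier L" "\<And>x. x \<in> (\<lambda>i. \<Squnion>(F i)) ` I \<Longrightarrow> x \<sqsubseteq> v" for v
  proof (rule sup_least[OF U v(1)])
    fix y assume "y \<in> (\<Union>i\<in>I. F i)"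
    then obtain i where i: "i \<in> I" "y \<in> F i" by blast
    have "y \<sqsubseteq> \<Squnion>(F i)" using assms i by (intro sup_ge)
    moreover have "\<Squnion>(F i) \<sqsubseteq> v" using i v by blast
    moreover have "y \<in> carrier L" "\<Squnion>(F i) \<in> carrier L"
      using assms i sup_in_carrier by blast+
    ultimately show "y \<sqsubseteq> v" using v(1) le_trans by blast
  qed
qed

text \<open>Both iterated joins flatten to the join of the one set of all values
  \<open>F i x\<close>. This exchange is what makes a pointwise join of homomorphisms preserve
  joins.\<close>

lemma sup_swap:
  assumes "\<And>i x. i \<in> I \<Longrightarrow> x \<in> X \<Longrightarrow> F i x \<in> carrier L"
  shows "\<Squnion>((\<lambda>i. \<Squnion>((\<lambda>x. F i x) ` X)) ` I) = \<Squnion>((\<lambda>x. \<Squnion>((\<lambda>i. F i x) ` I)) ` X)"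
proof -
  have "(\<Union>i\<in>I. (\<lambda>x. F i x) ` X) = (\<Union>x\<in>X. (\<lambda>i. F i x) ` I)" by blast
  moreover have "\<And>i. i \<in> I \<Longrightarrow> (\<lambda>x. F i x) ` X \<subseteq> carrier L"
    and "\<And>x. x \<in> X \<Longrightarrow> (\<lambda>i. F i x) ` I \<subseteq> carrier L"
    using assms by blast+
  ultimately show ?thesis by (simp add: sup_UN_eq)
qed

end

section \<open>Left and right modules, homomorphisms\<close>

fun mult_law :: "side \<Rightarrow> ('m, 'q::quantale) qmodule \<Rightarrow> bool" where
  "mult_law Left M \<longleftrightarrow>
    (\<forall>p q. \<forall>m\<in>carrier M. (p * q) \<star>\<^bsub>M\<^esub> m = p \<star>\<^bsub>M\<^esub> (q \<star>\<^bsub>M\<^esub> m))"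
| "mult_law Right M \<longleftrightarrow>
    (\<forall>p q. \<forall>m\<in>carrier M. (p * q) \<star>\<^bsub>M\<^esub> m = q \<star>\<^bsub>M\<^esub> (p \<star>\<^bsub>M\<^esub> m))"

text \<open>Isolates the single axiom in which left and right modules differ. Everything else can
  then be proved once, for \<open>pre_qmodule\<close>, and serves both sides.\<close>

lemma is_qmodule_iff: "is_qmodule s M \<longleftrightarrow> pre_qmodule M \<and> mult_law s M"
  by (cases s) (auto simp: left_qmodule_def left_qmodule_axioms_def
      right_qmodule_def right_qmodule_axioms_def)

lemma qmodule_homI:
  assumes "\<And>x. x \<in> carrier A \<Longrightarrow> f x \<in> carrier B"
    and "\<And>X. X \<subseteq> carrier A \<Longrightarrow> f (\<Squnion>\<^bsub>A\<^esub> X) = \<Squnion>\<^bsub>B\<^esub> (f ` X)"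
    and "\<And>q x. x \<in> carrier A \<Longrightarrow> f (q \<star>\<^bsub>A\<^esub> x) = q \<star>\<^bsub>B\<^esub> f x"
  shows "f \<in> qmodule_hom A B"
  using assms by (auto simp: qmodule_hom_def)

lemma qmodule_homD:
  assumes "f \<in> qmodule_hom A B"
  shows "x \<in> carrier A \<Longrightarrow> f x \<in> carrier B"
    and "X \<subseteq> carrier A \<Longrightarrow> f (\<Squnion>\<^bsub>A\<^esub> X) = \<Squnion>\<^bsub>B\<^esub> (f ` X)"
    and "x \<in> carrier A \<Longrightarrow> f (q \<star>\<^bsub>A\<^esub> x) = q \<star>\<^bsub>B\<^esub> f x"
  using assms by (auto simp: qmodule_hom_def)

lemma qmodule_hom_comp:
  assumes f: "f \<in> qmodule_hom A B" and g: "g \<in> qmodule_hom B C"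
  shows "(\<lambda>x. g (f x)) \<in> qmodule_hom A C"
proof (rule qmodule_homI)
  fix X assume X: "X \<subseteq> carrier A"
  then have "f ` X \<subseteq> carrier B" using qmodule_homD(1)[OF f] by blast
  then show "g (f (\<Squnion>\<^bsub>A\<^esub> X)) = \<Squnion>\<^bsub>C\<^esub> ((\<lambda>x. g (f x)) ` X)"
    using X by (simp add: qmodule_homD[OF f] qmodule_homD[OF g] image_image)
qed (auto simp: qmodule_homD[OF f] qmodule_homD[OF g])

context pre_qmodule
begin

text \<open>Preservation of joins, read at the empty join: scalars fix the least element. Hence a
  coordinate filled with the least element stays so under the action.\<close>

lemma act_bot: "q \<star> \<Squnion>{} = \<Squnion>{}"
  using act_sup[of "{}" q] by simp

end

section \<open>The module structure of the product\<close>

lemma qmodule_prod_simps [simp]: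
  "carrier (qmodule_prod I M) = (\<Pi>\<^sub>E i\<in>I. carrier (M i))"
  "x .=\<^bsub>qmodule_prod I M\<^esub> y \<longleftrightarrow> x = y"
  "x \<sqsubseteq>\<^bsub>qmodule_prod I M\<^esub> y \<longleftrightarrow> (\<forall>i\<in>I. x i \<sqsubseteq>\<^bsub>M i\<^esub> y i)"
  "q \<star>\<^bsub>qmodule_prod I M\<^esub> x = (\<lambda>i\<in>I. q \<star>\<^bsub>M i\<^esub> x i)"
  by (simp_all add: qmodule_prod_def)

locale qmodule_family =
  fixes I :: "'i set" and M :: "'i \<Rightarrow> ('m, 'q::quantale) qmodule"
  assumes component: "i \<in> I \<Longrightarrow> pre_qmodule (M i)"
begin

lemma sup_component: "i \<in> I \<Longrightarrow> sup_lattice (M i)"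
  using component by (simp add: pre_qmodule_def)

lemma partial_order_component: "i \<in> I \<Longrightarrow> partial_order (M i)"
  using sup_component by (simp add: sup_lattice_def)

lemma weak_partial_order_component: "i \<in> I \<Longrightarrow> weak_partial_order (M i)"
  using partial_order_component by (simp add: partial_order_def)

lemma partial_order_prod: "partial_order (qmodule_prod I M)"
proof unfold_locales
  fix x y z
  assume x: "x \<in> carrier (qmodule_prod I M)" and y: "y \<in> carrier (qmodule_prod I M)"
  show "x \<sqsubseteq>\<^bsub>qmodule_prod I M\<^esub> x"
    using x by (auto intro: weak_partial_order.le_refl[OF weak_partial_order_component])
  show "x .=\<^bsub>qmodule_prod I M\<^esub> y"
    if "x \<sqsubseteq>\<^bsub>qmodule_prod I M\<^esub> y" "y \<sqsubseteq>\<^bsub>qmodule_prod I M\<^esub> x"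
  proof -
    have "x i = y i" if "i \<in> I" for i
      using x y \<open>x \<sqsubseteq>\<^bsub>qmodule_prod I M\<^esub> y\<close> \<open>y \<sqsubseteq>\<^bsub>qmodule_prod I M\<^esub> x\<close> that
      by (intro partial_order.le_antisym[OF partial_order_component[OF that]]) auto
    \<comment> \<open>Outside \<open>I\<close> both functions are \<open>undefined\<close>, since
      the carrier consists of extensional functions; agreement on \<open>I\<close> therefore gives
      equality.\<close>
    then show ?thesis
      using x y by (simp add: PiE_ext)
  qed
  assume z: "z \<in> carrier (qmodule_prod I M)"
  show "x \<sqsubseteq>\<^bsub>qmodule_prod I M\<^esub> z"
    if "x \<sqsubseteq>\<^bsub>qmodule_prod I M\<^esub> y" "y \<sqsubseteq>\<^bsub>qmodule_prod I M\<^esub> z"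
    using x y z that
    by (auto intro: weak_partial_order.le_trans[OF weak_partial_order_component])
qed (auto simp: fun_eq_iff)

lemma proj_image: "X \<subseteq> (\<Pi>\<^sub>E i\<in>I. carrier (M i)) \<Longrightarrow> i \<in> I \<Longrightarrow> (\<lambda>x. x i) ` X \<subseteq> carrier (M i)"
  by auto

text \<open>An explicit candidate for the join. The chosen \<open>\<Squnion>\<close> of the product
  cannot be computed before some least upper bound is known to exist there.\<close>

definition coord_sup :: "('i \<Rightarrow> 'm) set \<Rightarrow> 'i \<Rightarrow> 'm" where
  "coord_sup X = (\<lambda>i\<in>I. \<Squnion>\<^bsub>M i\<^esub> ((\<lambda>x. x i) ` X))"

lemma coord_sup_closed:
  assumes "X \<subseteq> (\<Pi>\<^sub>E i\<in>I. carrier (M i))"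
  shows "coord_sup X \<in> (\<Pi>\<^sub>E i\<in>I. carrier (M i))"
  unfolding coord_sup_def
  by (auto intro!: sup_lattice.sup_in_carrier[OF sup_component] proj_image[OF assms])

lemma coord_sup_ge:
  assumes "X \<subseteq> (\<Pi>\<^sub>E i\<in>I. carrier (M i))" "x \<in> X"
  shows "x \<sqsubseteq>\<^bsub>qmodule_prod I M\<^esub> coord_sup X"
  unfolding coord_sup_def using assms(2)
  by (auto intro!: sup_lattice.sup_ge[OF sup_component] proj_image[OF assms(1)])

lemma coord_sup_least:
  assumes "X \<subseteq> (\<Pi>\<^sub>E i\<in>I. carrier (M i))" "v \<in> (\<Pi>\<^sub>E i\<in>I. carrier (M i))"
    and "\<And>x. x \<in> X \<Longrightarrow> x \<sqsubseteq>\<^bsub>qmodule_prod I M\<^esub> v"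
  shows "coord_sup X \<sqsubseteq>\<^bsub>qmodule_prod I M\<^esub> v"
proof -
  have "\<Squnion>\<^bsub>M i\<^esub> ((\<lambda>x. x i) ` X) \<sqsubseteq>\<^bsub>M i\<^esub> v i" if i: "i \<in> I" for i
    using assms(2,3) i
    by (intro sup_lattice.sup_least[OF sup_component[OF i] proj_image[OF assms(1) i]]) auto
  then show ?thesis by (simp add: coord_sup_def)
qed

lemma sup_lattice_prod: "sup_lattice (qmodule_prod I M)"
proof -
  interpret partial_order "qmodule_prod I M" by (rule partial_order_prod)
  show ?thesis
  proof unfold_locales
    fix X assume X: "X \<subseteq> carrier (qmodule_prod I M)"
    then have X': "X \<subseteq> (\<Pi>\<^sub>E i\<in>I. carrier (M i))" by simp
    have "least (qmodule_prod I M) (coord_sup X) (Upper (qmodule_prod I M) X)"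
      using coord_sup_closed[OF X'] coord_sup_ge[OF X'] X
      by (intro least_UpperI coord_sup_least[OF X'])
        (auto simp: Upper_def subset_iff simp del: qmodule_prod_simps(3))
    then show "\<exists>s. least (qmodule_prod I M) s (Upper (qmodule_prod I M) X)" by blast
  qed
qed

text \<open>Now that the product is a sup-lattice, uniqueness of least upper bounds identifies the
  chosen join with \<open>coord_sup\<close>. From here on joins are computed coordinatewise.\<close>

lemma sup_prod:
  assumes "X \<subseteq> (\<Pi>\<^sub>E i\<in>I. carrier (M i))"
  shows "\<Squnion>\<^bsub>qmodule_prod I M\<^esub> X = (\<lambda>i\<in>I. \<Squnion>\<^bsub>M i\<^esub> ((\<lambda>x. x i) ` X))"
  unfolding coord_sup_def[symmetric]
  using assms coord_sup_closed[OF assms] coord_sup_ge[OF assms] coord_sup_least[OF assms]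
  by (intro sup_lattice.sup_eqI[OF sup_lattice_prod])
    (simp_all del: qmodule_prod_simps(3))

lemma pre_qmodule_prod: "pre_qmodule (qmodule_prod I M)"
proof -
  interpret sup_lattice "qmodule_prod I M" by (rule sup_lattice_prod)
  \<comment> \<open>Besides giving closure, this puts images under the action inside the carrier,
    which \<open>sup_prod\<close> requires in both distributive laws.\<close>
  have act_in: "(\<lambda>i\<in>I. q \<star>\<^bsub>M i\<^esub> x i) \<in> (\<Pi>\<^sub>E i\<in>I. carrier (M i))"
    if "x \<in> (\<Pi>\<^sub>E i\<in>I. carrier (M i))" for q x
    using that by (auto intro!: pre_qmodule.act_closed[OF component])
  show ?thesis
  proof unfold_locales
    fix x q assume x: "x \<in> carrier (qmodule_prod I M)"
    show "q \<star>\<^bsub>qmodule_prod I M\<^esub> x \<in> carrier (qmodule_prod I M)"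
      using x act_in by simp
    have "1 \<star>\<^bsub>M i\<^esub> x i = x i" if "i \<in> I" for i
      using x that by (intro pre_qmodule.one_act[OF component]) auto
    then show "1 \<star>\<^bsub>qmodule_prod I M\<^esub> x = x"
      using x by (simp cong: restrict_cong)
  next
    fix x :: "'i \<Rightarrow> 'm" and X :: "'q set"
    assume x: "x \<in> carrier (qmodule_prod I M)"
    then have "(\<lambda>q. q \<star>\<^bsub>qmodule_prod I M\<^esub> x) ` X \<subseteq> (\<Pi>\<^sub>E i\<in>I. carrier (M i))"
      using act_in by fastforce
    moreover have "Sup X \<star>\<^bsub>M i\<^esub> x i = \<Squnion>\<^bsub>M i\<^esub> ((\<lambda>q. q \<star>\<^bsub>M i\<^esub> x i) ` X)" if "i \<in> I" for i
      using x that by (intro pre_qmodule.Sup_act[OF component]) auto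
    ultimately show "Sup X \<star>\<^bsub>qmodule_prod I M\<^esub> x =
        \<Squnion>\<^bsub>qmodule_prod I M\<^esub> ((\<lambda>q. q \<star>\<^bsub>qmodule_prod I M\<^esub> x) ` X)"
      by (auto simp: sup_prod image_image cong: restrict_cong)
  next
    fix q :: 'q and Y :: "('i \<Rightarrow> 'm) set"
    assume "Y \<subseteq> carrier (qmodule_prod I M)"
    then have Y: "Y \<subseteq> (\<Pi>\<^sub>E i\<in>I. carrier (M i))" by simp
    then have "(\<lambda>x. q \<star>\<^bsub>qmodule_prod I M\<^esub> x) ` Y \<subseteq> (\<Pi>\<^sub>E i\<in>I. carrier (M i))"
      using act_in by fastforce
    moreover have "q \<star>\<^bsub>M i\<^esub> \<Squnion>\<^bsub>M i\<^esub> ((\<lambda>x. x i) ` Y) = \<Squnion>\<^bsub>M i\<^esub> ((\<lambda>x. q \<star>\<^bsub>M i\<^esub> x i) ` Y)"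
      if i: "i \<in> I" for i
      using pre_qmodule.act_sup[OF component[OF i] proj_image[OF Y i]] by (simp add: image_image)
    ultimately show "q \<star>\<^bsub>qmodule_prod I M\<^esub> \<Squnion>\<^bsub>qmodule_prod I M\<^esub> Y =
        \<Squnion>\<^bsub>qmodule_prod I M\<^esub> ((\<lambda>x. q \<star>\<^bsub>qmodule_prod I M\<^esub> x) ` Y)"
      using Y by (auto simp: sup_prod image_image cong: restrict_cong)
  qed
qed

section \<open>The product as a coproduct: embeddings and cotupling\<close>

definition inj_at :: "'i \<Rightarrow> 'm \<Rightarrow> 'i \<Rightarrow> 'm" where
  "inj_at i m = (\<lambda>j\<in>I. if j = i then m else \<Squnion>\<^bsub>M j\<^esub> {})"

lemma bot_closed: "j \<in> I \<Longrightarrow> \<Squnion>\<^bsub>M j\<^esub> {} \<in> carrier (M j)"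
  by (rule sup_lattice.sup_in_carrier[OF sup_component]) auto

lemma inj_at_closed:
  "m \<in> carrier (M i) \<Longrightarrow> inj_at i m \<in> (\<Pi>\<^sub>E j\<in>I. carrier (M j))"
  by (auto simp: inj_at_def bot_closed)

lemma sup_bots:
  assumes j: "j \<in> I" and "S \<subseteq> {\<Squnion>\<^bsub>M j\<^esub> {}}"
  shows "\<Squnion>\<^bsub>M j\<^esub> S = \<Squnion>\<^bsub>M j\<^esub> {}"
proof -
  interpret sup_lattice "M j" using j by (rule sup_component)
  show ?thesis
    using assms(2) bot_closed[OF j] by (intro sup_eqI) (auto intro: sup_least)
qed

text \<open>Coordinate \<open>i\<close> is the identity, and every other coordinate is constantly
  the least element, which is stable under joins by \<open>sup_bots\<close> and under scalars by
  \<open>act_bot\<close>.\<close>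

lemma inj_at_hom:
  assumes "i \<in> I"
  shows "inj_at i \<in> qmodule_hom (M i) (qmodule_prod I M)"
proof (rule qmodule_homI)
  fix X assume X: "X \<subseteq> carrier (M i)"
  then have "inj_at i ` X \<subseteq> (\<Pi>\<^sub>E j\<in>I. carrier (M j))"
    using inj_at_closed by blast
  moreover have "\<Squnion>\<^bsub>M j\<^esub> ((\<lambda>m. inj_at i m j) ` X) = inj_at i (\<Squnion>\<^bsub>M i\<^esub> X) j" if "j \<in> I" for j
    using that by (auto simp: inj_at_def intro!: sup_bots)
  ultimately show "inj_at i (\<Squnion>\<^bsub>M i\<^esub> X) = \<Squnion>\<^bsub>qmodule_prod I M\<^esub> (inj_at i ` X)"
    by (auto simp: sup_prod image_image fun_eq_iff) (simp add: inj_at_def)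
next
  show "inj_at i (q \<star>\<^bsub>M i\<^esub> m) = q \<star>\<^bsub>qmodule_prod I M\<^esub> inj_at i m" for q m
    by (auto simp: inj_at_def fun_eq_iff pre_qmodule.act_bot[OF component])
qed (use inj_at_closed in auto)

text \<open>In coordinate \<open>j\<close> the joined values are \<open>x j\<close>, contributed by
  \<open>i = j\<close>, and least elements, so \<open>x j\<close> is the greatest of them. A
  homomorphism on the product is thereby determined by its composites with the embeddings.\<close>

lemma sup_inj_at:
  assumes x: "x \<in> (\<Pi>\<^sub>E j\<in>I. carrier (M j))"
  shows "\<Squnion>\<^bsub>qmodule_prod I M\<^esub> ((\<lambda>i. inj_at i (x i)) ` I) = x"
proof -
  have "(\<lambda>i. inj_at i (x i)) ` I \<subseteq> (\<Pi>\<^sub>E j\<in>I. carrier (M j))"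
    using x by (auto intro!: inj_at_closed)
  moreover have "\<Squnion>\<^bsub>M j\<^esub> ((\<lambda>i. inj_at i (x i) j) ` I) = x j" if j: "j \<in> I" for j
  proof -
    interpret sup_lattice "M j" using j by (rule sup_component)
    have xj: "x j \<in> carrier (M j)" using x j by auto
    show ?thesis
    proof (rule sup_eqI)
      show "v \<in> carrier (M j) \<Longrightarrow> (\<And>y. y \<in> (\<lambda>i. inj_at i (x i) j) ` I \<Longrightarrow> y \<sqsubseteq>\<^bsub>M j\<^esub> v)
          \<Longrightarrow> x j \<sqsubseteq>\<^bsub>M j\<^esub> v" for v
        using j by (force simp: inj_at_def)
    qed (use xj j bot_closed in \<open>auto simp: inj_at_def intro: sup_least\<close>)
  qed
  ultimately show ?thesis
    using x by (simp add: sup_prod image_image cong: restrict_cong)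
qed

text \<open>The map out of the coproduct induced by the \<open>h i\<close>. For joins, compute
  coordinatewise, move each \<open>h i\<close> inside and exchange the two joins by
  \<open>sup_swap\<close>; for scalars, use that the action on \<open>A\<close> distributes over the
  join over \<open>I\<close>.\<close>

lemma cotuple_hom:
  assumes A: "pre_qmodule A" and h: "\<And>i. i \<in> I \<Longrightarrow> h i \<in> qmodule_hom (M i) A"
  shows "(\<lambda>x. \<Squnion>\<^bsub>A\<^esub> ((\<lambda>i. h i (x i)) ` I)) \<in> qmodule_hom (qmodule_prod I M) A"
proof -
  interpret A: pre_qmodule A by (rule A)
  have h_in: "h i (x i) \<in> carrier A" if "i \<in> I" "x \<in> (\<Pi>\<^sub>E j\<in>I. carrier (M j))" for i x
    using that by (intro qmodule_homD(1)[OF h]) auto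
  show ?thesis
  proof (rule qmodule_homI)
    show "\<Squnion>\<^bsub>A\<^esub> ((\<lambda>i. h i (x i)) ` I) \<in> carrier A" if "x \<in> carrier (qmodule_prod I M)" for x
      using that h_in by (intro A.sup_in_carrier) auto
  next
    fix X assume "X \<subseteq> carrier (qmodule_prod I M)"
    then have X: "X \<subseteq> (\<Pi>\<^sub>E j\<in>I. carrier (M j))" by simp
    have "h i (\<Squnion>\<^bsub>M i\<^esub> ((\<lambda>x. x i) ` X)) = \<Squnion>\<^bsub>A\<^esub> ((\<lambda>x. h i (x i)) ` X)" if i: "i \<in> I" for i
      using qmodule_homD(2)[OF h[OF i] proj_image[OF X i]] by (simp add: image_image)
    moreover have "\<Squnion>\<^bsub>A\<^esub> ((\<lambda>i. \<Squnion>\<^bsub>A\<^esub> ((\<lambda>x. h i (x i)) ` X)) ` I) =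
        \<Squnion>\<^bsub>A\<^esub> ((\<lambda>x. \<Squnion>\<^bsub>A\<^esub> ((\<lambda>i. h i (x i)) ` I)) ` X)"
      using X h_in by (intro A.sup_swap) blast
    ultimately show "\<Squnion>\<^bsub>A\<^esub> ((\<lambda>i. h i ((\<Squnion>\<^bsub>qmodule_prod I M\<^esub> X) i)) ` I) =
        \<Squnion>\<^bsub>A\<^esub> ((\<lambda>x. \<Squnion>\<^bsub>A\<^esub> ((\<lambda>i. h i (x i)) ` I)) ` X)"
      by (simp add: sup_prod[OF X] cong: image_cong)
  next
    fix q x assume "x \<in> carrier (qmodule_prod I M)"
    then have x: "x \<in> (\<Pi>\<^sub>E j\<in>I. carrier (M j))" by simp
    have "h i (q \<star>\<^bsub>M i\<^esub> x i) = q \<star>\<^bsub>A\<^esub> h i (x i)" if i: "i \<in> I" for i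
      using x i by (intro qmodule_homD(3)[OF h[OF i]]) auto
    moreover have "q \<star>\<^bsub>A\<^esub> \<Squnion>\<^bsub>A\<^esub> ((\<lambda>i. h i (x i)) ` I) =
        \<Squnion>\<^bsub>A\<^esub> ((\<lambda>i. q \<star>\<^bsub>A\<^esub> h i (x i)) ` I)"
      using A.act_sup[of "(\<lambda>i. h i (x i)) ` I" q] x h_in by (auto simp: image_image)
    ultimately show "\<Squnion>\<^bsub>A\<^esub> ((\<lambda>i. h i ((q \<star>\<^bsub>qmodule_prod I M\<^esub> x) i)) ` I) =
        q \<star>\<^bsub>A\<^esub> \<Squnion>\<^bsub>A\<^esub> ((\<lambda>i. h i (x i)) ` I)"
      by (simp cong: image_cong)
  qed
qed

section \<open>Projections and tupling\<close>

lemma proj_hom: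
  assumes "i \<in> I"
  shows "(\<lambda>x. x i) \<in> qmodule_hom (qmodule_prod I M) (M i)"
  using assms by (intro qmodule_homI) (auto simp: sup_prod)

lemma tuple_hom:
  assumes g: "\<And>i. i \<in> I \<Longrightarrow> g i \<in> qmodule_hom A (M i)"
  shows "(\<lambda>a. \<lambda>i\<in>I. g i a) \<in> qmodule_hom A (qmodule_prod I M)"
proof (rule qmodule_homI)
  show closed: "(\<lambda>i\<in>I. g i a) \<in> carrier (qmodule_prod I M)" if "a \<in> carrier A" for a
    using that by (auto intro: qmodule_homD(1)[OF g])
  show "(\<lambda>i\<in>I. g i (\<Squnion>\<^bsub>A\<^esub> X)) = \<Squnion>\<^bsub>qmodule_prod I M\<^esub> ((\<lambda>a. \<lambda>i\<in>I. g i a) ` X)"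
    if X: "X \<subseteq> carrier A" for X
  proof -
    have "(\<lambda>a. \<lambda>i\<in>I. g i a) ` X \<subseteq> (\<Pi>\<^sub>E i\<in>I. carrier (M i))"
      using X closed by fastforce
    then show ?thesis
      using X by (auto simp: sup_prod image_image qmodule_homD(2)[OF g] cong: restrict_cong)
  qed
  show "(\<lambda>i\<in>I. g i (q \<star>\<^bsub>A\<^esub> a)) = q \<star>\<^bsub>qmodule_prod I M\<^esub> (\<lambda>i\<in>I. g i a)"
    if "a \<in> carrier A" for q a
    using that by (auto simp: qmodule_homD(3)[OF g] cong: restrict_cong)
qed

end

section \<open>Products of projective and of injective modules\<close>

lemma is_qmodule_prod:
  assumes "\<And>i. i \<in> I \<Longrightarrow> is_qmodule s (M i)"
  shows "is_qmodule s (qmodule_prod I M)"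
proof -
  interpret qmodule_family I M
    by (rule qmodule_family.intro) (use assms is_qmodule_iff in blast)
  have "\<And>i. i \<in> I \<Longrightarrow> mult_law s (M i)"
    using assms is_qmodule_iff by blast
  \<comment> \<open>Either law is an equation between functions restricted to \<open>I\<close>, so
    it is checked one coordinate at a time.\<close>
  then have "mult_law s (qmodule_prod I M)"
    by (cases s) (fastforce dest: PiE_mem intro!: restrict_ext)+
  then show ?thesis
    using pre_qmodule_prod by (simp add: is_qmodule_iff)
qed

lemma projective_qmodule_prod:
  fixes M :: "'i \<Rightarrow> ('m, 'q::quantale) qmodule"
  assumes M: "\<And>i. i \<in> I \<Longrightarrow> projective_qmodule s TYPE('a) TYPE('b) (M i)"
  shows "projective_qmodule s TYPE('a) TYPE('b) (qmodule_prod I M)"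
  unfolding projective_qmodule_def
proof (intro conjI allI impI ballI)
  have mods: "\<And>i. i \<in> I \<Longrightarrow> is_qmodule s (M i)"
    using M by (auto simp: projective_qmodule_def)
  interpret qmodule_family I M
    by (rule qmodule_family.intro) (use mods is_qmodule_iff in blast)
  show "is_qmodule s (qmodule_prod I M)"
    by (rule is_qmodule_prod) (rule mods)
  fix A :: "('a, 'q) qmodule" and B :: "('b, 'q) qmodule" and f e
  assume AB: "is_qmodule s A \<and> is_qmodule s B"
    and f: "f \<in> qmodule_hom (qmodule_prod I M) B"
    and e: "e \<in> qmodule_hom A B" "e ` carrier A = carrier B"
  \<comment> \<open>Projectivity of \<open>M i\<close>, against the same surjection
    \<open>e\<close>, lifts the composite of \<open>f\<close> with the embedding of
    \<open>M i\<close>.\<close>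
  have "\<exists>h\<in>qmodule_hom (M i) A. \<forall>m\<in>carrier (M i). e (h m) = f (inj_at i m)" if i: "i \<in> I" for i
    using AB e qmodule_hom_comp[OF inj_at_hom[OF i] f]
    by (intro M[OF i, unfolded projective_qmodule_def, THEN conjunct2, rule_format])
  then obtain h where h: "\<And>i. i \<in> I \<Longrightarrow> h i \<in> qmodule_hom (M i) A"
    and eh: "\<And>i m. i \<in> I \<Longrightarrow> m \<in> carrier (M i) \<Longrightarrow> e (h i m) = f (inj_at i m)"
    by metis
  show "\<exists>h\<in>qmodule_hom (qmodule_prod I M) A. \<forall>x\<in>carrier (qmodule_prod I M). e (h x) = f x"
  \<comment> \<open>The lifting is the cotuple of the chosen \<open>h i\<close>; matching with
    \<open>cotuple_hom\<close> supplies it as the witness.\<close>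
  proof (rule bexI[OF _ cotuple_hom])
    show "pre_qmodule A" using AB is_qmodule_iff by blast
    show "\<And>i. i \<in> I \<Longrightarrow> h i \<in> qmodule_hom (M i) A" by (rule h)
    show "\<forall>x\<in>carrier (qmodule_prod I M). e (\<Squnion>\<^bsub>A\<^esub> ((\<lambda>i. h i (x i)) ` I)) = f x"
    proof
      fix x assume "x \<in> carrier (qmodule_prod I M)"
      then have x: "x \<in> (\<Pi>\<^sub>E j\<in>I. carrier (M j))" by simp
      then have xi: "\<And>i. i \<in> I \<Longrightarrow> x i \<in> carrier (M i)" by auto
      \<comment> \<open>Push \<open>e\<close> through the join, replace each
        \<open>e (h i (x i))\<close> by \<open>f (inj_at i (x i))\<close>, pull \<open>f\<close> out
        of the join again, and recognise the argument as \<open>x\<close> by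
        \<open>sup_inj_at\<close>.\<close>
      have "e (\<Squnion>\<^bsub>A\<^esub> ((\<lambda>i. h i (x i)) ` I)) = \<Squnion>\<^bsub>B\<^esub> (e ` (\<lambda>i. h i (x i)) ` I)"
        using xi qmodule_homD(1)[OF h] by (intro qmodule_homD(2)[OF e(1)]) blast
      also have "\<dots> = \<Squnion>\<^bsub>B\<^esub> (f ` (\<lambda>i. inj_at i (x i)) ` I)"
        using xi by (simp add: image_image eh cong: image_cong)
      also have "\<dots> = f (\<Squnion>\<^bsub>qmodule_prod I M\<^esub> ((\<lambda>i. inj_at i (x i)) ` I))"
        using xi by (intro qmodule_homD(2)[OF f, symmetric]) (auto intro!: inj_at_closed)
      finally show "e (\<Squnion>\<^bsub>A\<^esub> ((\<lambda>i. h i (x i)) ` I)) = f x"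
        by (simp add: sup_inj_at[OF x])
    qed
  qed
qed

lemma injective_qmodule_prod:
  fixes M :: "'i \<Rightarrow> ('m, 'q::quantale) qmodule"
  assumes M: "\<And>i. i \<in> I \<Longrightarrow> injective_qmodule s TYPE('a) TYPE('b) (M i)"
  shows "injective_qmodule s TYPE('a) TYPE('b) (qmodule_prod I M)"
  unfolding injective_qmodule_def
proof (intro conjI allI impI ballI)
  have mods: "\<And>i. i \<in> I \<Longrightarrow> is_qmodule s (M i)"
    using M by (auto simp: injective_qmodule_def)
  interpret qmodule_family I M
    by (rule qmodule_family.intro) (use mods is_qmodule_iff in blast)
  show "is_qmodule s (qmodule_prod I M)"
    by (rule is_qmodule_prod) (rule mods)
  fix A :: "('a, 'q) qmodule" and B :: "('b, 'q) qmodule" and m f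
  assume AB: "is_qmodule s A \<and> is_qmodule s B"
    and m: "m \<in> qmodule_hom B A" "inj_on m (carrier B)"
    and f: "f \<in> qmodule_hom B (qmodule_prod I M)"
  \<comment> \<open>Injectivity of \<open>M i\<close> extends the \<open>i\<close>-th coordinate of
    \<open>f\<close> along the same embedding \<open>m\<close>.\<close>
  have "\<exists>g\<in>qmodule_hom A (M i). \<forall>x\<in>carrier B. g (m x) = f x i" if i: "i \<in> I" for i
    using AB m qmodule_hom_comp[OF f proj_hom[OF i]]
    by (intro M[OF i, unfolded injective_qmodule_def, THEN conjunct2, rule_format])
  then obtain g where g: "\<And>i. i \<in> I \<Longrightarrow> g i \<in> qmodule_hom A (M i)"
    and gm: "\<And>i x. i \<in> I \<Longrightarrow> x \<in> carrier B \<Longrightarrow> g i (m x) = f x i"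
    by metis
  show "\<exists>g\<in>qmodule_hom A (qmodule_prod I M). \<forall>x\<in>carrier B. g (m x) = f x"
  \<comment> \<open>The extension is the tuple of the chosen \<open>g i\<close>, supplied as witness
    by \<open>tuple_hom\<close>.\<close>
  proof (rule bexI[OF _ tuple_hom])
    show "\<And>i. i \<in> I \<Longrightarrow> g i \<in> qmodule_hom A (M i)" by (rule g)
    show "\<forall>x\<in>carrier B. (\<lambda>i\<in>I. g i (m x)) = f x"
    proof
      fix x assume x: "x \<in> carrier B"
      have "f x \<in> (\<Pi>\<^sub>E j\<in>I. carrier (M j))"
        using qmodule_homD(1)[OF f x] by simp
      \<comment> \<open>Being extensional, \<open>f x\<close> equals its own restriction to
        \<open>I\<close>, so the coordinate equations suffice.\<close>
      then show "(\<lambda>i\<in>I. g i (m x)) = f x"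
        using x by (simp add: gm cong: restrict_cong)
    qed
  qed
qed

theorem theorem4p5p8:
  fixes M :: "'i \<Rightarrow> ('m, 'q::quantale) qmodule" and I :: "'i set" and s :: side
  shows "((\<forall>i\<in>I. projective_qmodule s TYPE('a) TYPE('b) (M i)) \<longrightarrow>
            projective_qmodule s TYPE('a) TYPE('b) (qmodule_prod I M)) \<and>
         ((\<forall>i\<in>I. injective_qmodule s TYPE('a) TYPE('b) (M i)) \<longrightarrow>
            injective_qmodule s TYPE('a) TYPE('b) (qmodule_prod I M))"
  by (blast intro: projective_qmodule_prod injective_qmodule_prod)

end
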